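(* Let $X$ be a planar polynomial vector field such that the upper principal part $X^{U}_{\Delta}$ is non degenerated. After the suitable Poincaré--Lyapunov compactification with weight $\omega=(\alpha,\beta)$, all the singularities in the infinity outside the origin of the (positive and negative) $x$ and $y$ directions are either hyperbolic or semi-hyperbolic; that is, for each of the four compactified vector fields $\overline{X}^{+}_{x},\overline{X}^{-}_{x},\overline{X}^{+}_{y},\overline{X}^{-}_{y}$, every singularity of the form $(\bar u,0)$ with $\bar u\neq 0$ is hyperbolic or semi-hyperbolic.
   Context: **Newton polytope.** Every planar polynomial vector field is written uniquely as a finite sum $X(x,y)=\sum_{m,n} x^{m}y^{n}\big(a_{m,n}x\frac{\partial}{\partial x}+b_{m,n}y\frac{\partial}{\partial y}\big)$ with $m,n\in\mathbb{Z}$, $a_{m,n},b_{m,n}\in\mathbb{R}$, where $a_{m,n}=0$ if $m<-1$ or $n\le -1$, and $b_{m,n}=0$ if $m\le -1$ or $n<-1$. The support is $\mathcal{S}=\{(m,n)\in\mathbb{Z}^2: a_{m,n}^2+b_{m,n}^2\neq 0\}$ and the Newton polytope $\mathcal{P}$ is the convex hull of $\mathcal{S}$. Let $\mathcal{P}_+$ be the convex hull of $\mathcal{S}+(\mathbb{R}_{\ge 0})^2$. If $\mathcal{P}$ has non-empty interior, the upper boundary $\mathcal{P}^U$ is the closure of $\partial\mathcal{P}\setminus\partial\mathcal{P}_+$; if $\mathcal{P}$ has empty interior, $\mathcal{P}^U=\mathcal{P}$. $\mathcal{P}$ is favorable if $\mathcal{P}^U$ has at least one segment with negative slope. **Upper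 principal part.** $X_{\Delta}^{U}(x,y)=\sum_{(m,n)\in\mathcal{P}^U}x^my^n\big(a_{m,n}x\frac{\partial}{\partial x}+b_{m,n}y\frac{\partial}{\partial y}\big)$. It is non degenerated if for every segment $\gamma_j\subset\mathcal{P}^U$ the vector field $X_{\gamma_j}(x,y)=\sum_{(m,n)\in\gamma_j}x^my^n\big(a_{m,n}x\frac{\partial}{\partial x}+b_{m,n}y\frac{\partial}{\partial y}\big)$ has no singularities (zeros) in $(\mathbb{R}\setminus\{0\})^2$. **Suitable weight.** The upper main vertex $p_h=(m_h,n_h)$ is the last point of $\mathcal{S}$ in lexicographical order such that $n_h\ge n$ for all $(m,n)\in\mathcal{P}$; the upper main segment $\gamma_h$ is the edge of $\mathcal{P}$ that ends at $p_h$ when $\partial\mathcal{P}$ is traversed counterclockwise. If $\mathcal{P}$ is favorable, $\gamma_h$ lies in a line $\{\alpha m+\beta n=\delta\}$ with $\alpha,\beta$ positive integers, and the suitable weight is this $(\alpha,\beta)$. If $\mathcal{P}$ is not favorable, the classical Poincaré compactification is used, i.e. $(\alpha,\beta)=(1,1)$. **Compactification charts.** Let $D=\max\{\alpha m+\beta n:(m,n)\in\mathcal{S}\}$. The vector fields $\overline{X}^{\pm}_{x}$ (positive/negative $x$-direction) and $\overline{X}^{\pm}_{y}$ (positive/negative $y$-direction) are obtained from $X$ by the changes of variables $x=\pm v^{-\alpha},\ y=uv^{-\beta}$ and $x=uv^{-\alpha},\ y=\pm v^{-\beta}$ respectively, followed by multiplication by $v^{D}$, which makes them extend analytically to $\{v=0\}$;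 in each chart the infinity is $\{v=0\}$. **Hyperbolicity.** A singularity is hyperbolic if all eigenvalues of the Jacobian matrix have nonzero real part, and semi-hyperbolic if the Jacobian matrix has exactly one nonzero eigenvalue. *)

theory Defs
  imports "HOL-Analysis.Analysis"
begin

section \<open>Planar polynomial vector fields and their Newton polytope\<close>

type_synonym plane = "real^2"

type_synonym coeffs = "int \<Rightarrow> int \<Rightarrow> real"

abbreviation lattice_point :: "int \<times> int \<Rightarrow> plane" where
  "lattice_point s \<equiv> vector [of_int (fst s), of_int (snd s)]"

definition support :: "coeffs \<Rightarrow> coeffs \<Rightarrow> (int \<times> int) set" where
  "support a b = {(m, n). (a m n)\<^sup>2 + (b m n)\<^sup>2 \<noteq> 0}"

text \<open>The part of \<open>\<Sum> x\<^sup>m y\<^sup>n (a\<^sub>m\<^sub>n x \<partial>/\<partial>x + b\<^sub>m\<^sub>n y \<partial>/\<partial>y)\<close> supported in \<open>T\<close>.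
  The factors \<open>x\<close> and \<open>y\<close> are merged into the exponents so that the terms with \<open>m = -1\<close> or
  \<open>n = -1\<close> take the right value on the coordinate axes, where \<open>0 powi (-1) * 0 = 0\<close>.\<close>

definition field_on :: "coeffs \<Rightarrow> coeffs \<Rightarrow> (int \<times> int) set \<Rightarrow> plane \<Rightarrow> plane" where
  "field_on a b T p =
     (\<Sum>(m, n)\<in>support a b \<inter> T.
        vector [a m n * (p $ 1) powi (m + 1) * (p $ 2) powi n,
                b m n * (p $ 1) powi m * (p $ 2) powi (n + 1)])"

text \<open>\<open>X\<close> is the polynomial vector field whose (unique) expansion has coefficients \<open>a\<close>, \<open>b\<close>.\<close>

definition polynomial_vector_field :: "(plane \<Rightarrow> plane) \<Rightarrow> coeffs \<Rightarrow> coeffs \<Rightarrow> bool" where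
  "polynomial_vector_field X a b \<longleftrightarrow>
     finite (support a b) \<and>
     (\<forall>m n. m < -1 \<or> n \<le> -1 \<longrightarrow> a m n = 0) \<and>
     (\<forall>m n. m \<le> -1 \<or> n < -1 \<longrightarrow> b m n = 0) \<and>
     X = field_on a b UNIV"

definition newton_polytope :: "coeffs \<Rightarrow> coeffs \<Rightarrow> plane set" where
  "newton_polytope a b = convex hull (lattice_point ` support a b)"

definition newton_polytope_plus :: "coeffs \<Rightarrow> coeffs \<Rightarrow> plane set" where
  "newton_polytope_plus a b =
     convex hull {lattice_point s + r | s r. s \<in> support a b \<and> r $ 1 \<ge> 0 \<and> r $ 2 \<ge> 0}"

definition upper_boundary :: "coeffs \<Rightarrow> coeffs \<Rightarrow> plane set" where
  "upper_boundary a b =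
     (if interior (newton_polytope a b) \<noteq> {}
      then closure (frontier (newton_polytope a b) - frontier (newton_polytope_plus a b))
      else newton_polytope a b)"

text \<open>If the polytope is itself a segment, it counts as one of its edges.\<close>

definition upper_segment :: "coeffs \<Rightarrow> coeffs \<Rightarrow> plane set \<Rightarrow> bool" where
  "upper_segment a b \<gamma> \<longleftrightarrow> \<gamma> edge_of newton_polytope a b \<and> \<gamma> \<subseteq> upper_boundary a b"

definition has_negative_slope :: "plane set \<Rightarrow> bool" where
  "has_negative_slope \<gamma> \<longleftrightarrow> (\<exists>p\<in>\<gamma>. \<exists>q\<in>\<gamma>. p $ 1 \<noteq> q $ 1 \<and> (q $ 2 - p $ 2) / (q $ 1 - p $ 1) < 0)"

definition favorable :: "coeffs \<Rightarrow> coeffs \<Rightarrow> bool" where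
  "favorable a b \<longleftrightarrow> (\<exists>\<gamma>. upper_segment a b \<gamma> \<and> has_negative_slope \<gamma>)"

definition upper_part_nondegenerate :: "coeffs \<Rightarrow> coeffs \<Rightarrow> bool" where
  "upper_part_nondegenerate a b \<longleftrightarrow>
     (\<forall>\<gamma>. upper_segment a b \<gamma> \<longrightarrow>
        (\<forall>p. p $ 1 \<noteq> 0 \<and> p $ 2 \<noteq> 0 \<longrightarrow> field_on a b {s. lattice_point s \<in> \<gamma>} p \<noteq> 0))"


section \<open>The suitable weight\<close>

definition upper_main_vertex :: "coeffs \<Rightarrow> coeffs \<Rightarrow> int \<times> int \<Rightarrow> bool" where
  "upper_main_vertex a b s \<longleftrightarrow>
     (let top = {(m, n) \<in> support a b. \<forall>q\<in>newton_polytope a b. q $ 2 \<le> of_int n}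
      in s \<in> top \<and> (\<forall>(m, n)\<in>top. m < fst s \<or> m = fst s \<and> n \<le> snd s))"

text \<open>A counterclockwise traversal runs along an edge from \<open>q\<close> to \<open>p\<close> if the polytope lies on the
  left of (or, when it is a segment, on) the directed line from \<open>q\<close> to \<open>p\<close>.\<close>

definition upper_main_segment :: "coeffs \<Rightarrow> coeffs \<Rightarrow> plane set \<Rightarrow> bool" where
  "upper_main_segment a b \<gamma> \<longleftrightarrow>
     \<gamma> edge_of newton_polytope a b \<and>
     (\<exists>s q. upper_main_vertex a b s \<and>
        (let p = lattice_point s in
           \<gamma> = closed_segment q p \<and>
           (\<forall>r\<in>newton_polytope a b.
              (p $ 1 - q $ 1) * (r $ 2 - q $ 2) - (p $ 2 - q $ 2) * (r $ 1 - q $ 1) \<ge> 0)))"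

text \<open>The line containing the upper main segment determines the weight only up to a positive
  factor; every positive integer choice is admitted.\<close>

definition suitable_weight :: "coeffs \<Rightarrow> coeffs \<Rightarrow> nat \<Rightarrow> nat \<Rightarrow> bool" where
  "suitable_weight a b \<alpha> \<beta> \<longleftrightarrow>
     (if favorable a b
      then \<alpha> > 0 \<and> \<beta> > 0 \<and>
           (\<exists>\<gamma> \<delta>. upper_main_segment a b \<gamma> \<and> \<gamma> \<subseteq> {p. real \<alpha> * p $ 1 + real \<beta> * p $ 2 = \<delta>})
      else \<alpha> = 1 \<and> \<beta> = 1)"


section \<open>Poincare--Lyapunov compactification\<close>

definition weighted_degree :: "coeffs \<Rightarrow> coeffs \<Rightarrow> nat \<Rightarrow> nat \<Rightarrow> int" where
  "weighted_degree a b \<alpha> \<beta> = Max ((\<lambda>(m, n). int \<alpha> * m + int \<beta> * n) ` support a b)"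

text \<open>The changes of variables, as maps \<open>(u, v) \<mapsto> (x, y)\<close>; the sign \<open>\<sigma> \<in> {1, -1}\<close> selects the
  positive or the negative direction.\<close>

definition chart_x :: "real \<Rightarrow> nat \<Rightarrow> nat \<Rightarrow> plane \<Rightarrow> plane" where
  "chart_x \<sigma> \<alpha> \<beta> p = vector [\<sigma> * (p $ 2) powi (- int \<alpha>), p $ 1 * (p $ 2) powi (- int \<beta>)]"

definition chart_y :: "real \<Rightarrow> nat \<Rightarrow> nat \<Rightarrow> plane \<Rightarrow> plane" where
  "chart_y \<sigma> \<alpha> \<beta> p = vector [p $ 1 * (p $ 2) powi (- int \<alpha>), \<sigma> * (p $ 2) powi (- int \<beta>)]"

definition change_of_variables :: "(plane \<Rightarrow> plane) \<Rightarrow> (plane \<Rightarrow> plane) \<Rightarrow> plane \<Rightarrow> plane" where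
  "change_of_variables \<phi> X p = matrix_inv (jacobian \<phi> (at p)) *v X (\<phi> p)"

text \<open>Multiplication by \<open>v\<^sup>D\<close>, and extension to \<open>v = 0\<close> by continuity; the value of the analytic
  extension at \<open>v = 0\<close> is that limit.\<close>

definition compactified :: "(plane \<Rightarrow> plane) \<Rightarrow> int \<Rightarrow> (plane \<Rightarrow> plane) \<Rightarrow> plane \<Rightarrow> plane" where
  "compactified \<phi> D X p =
     (let Y = (\<lambda>q. (q $ 2) powi D *\<^sub>R change_of_variables \<phi> X q)
      in if p $ 2 \<noteq> 0 then Y p else Lim (at p within {q. q $ 2 \<noteq> 0}) Y)"


section \<open>Singularities\<close>

definition eigenvalue :: "real^2^2 \<Rightarrow> complex \<Rightarrow> bool" where
  "eigenvalue A c \<longleftrightarrow> (\<exists>w. w \<noteq> 0 \<and> map_matrix complex_of_real A *v w = c *s w)"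

definition singularity :: "(plane \<Rightarrow> plane) \<Rightarrow> plane \<Rightarrow> bool" where
  "singularity Y p \<longleftrightarrow> Y p = 0"

definition hyperbolic :: "(plane \<Rightarrow> plane) \<Rightarrow> plane \<Rightarrow> bool" where
  "hyperbolic Y p \<longleftrightarrow> (\<forall>c. eigenvalue (jacobian Y (at p)) c \<longrightarrow> Re c \<noteq> 0)"

text \<open>Eigenvalues are counted with multiplicity: exactly one of the two is nonzero, so the other
  one is zero.\<close>

definition semi_hyperbolic :: "(plane \<Rightarrow> plane) \<Rightarrow> plane \<Rightarrow> bool" where
  "semi_hyperbolic Y p \<longleftrightarrow>
     eigenvalue (jacobian Y (at p)) 0 \<and> (\<exists>!c. c \<noteq> 0 \<and> eigenvalue (jacobian Y (at p)) c)"

end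

theory Submission
  imports Defs
begin

text \<open>
  Write \<open>x' = x A\<close>, \<open>y' = y B\<close>. In the \<open>x\<close>-chart the compactified field is
  \<open>u' = u (B - (\<beta>/\<alpha>) A)\<close>, \<open>v' = - v A / \<alpha>\<close> up to the factor \<open>v\<^sup>D\<close>, so that at \<open>v = 0\<close> only the terms
  of top weighted degree survive, evaluated at \<open>(\<plusminus>1, u)\<close>. The Jacobian there is upper triangular
  with lower right entry \<open>- A / \<alpha>\<close>. If this entry vanished at a singularity with \<open>u \<noteq> 0\<close>, then \<open>B\<close>
  would vanish as well, and the top part of \<open>X\<close> would have a zero off the axes. But the top part is
  carried by a vertex or by a segment of the upper boundary, so this contradicts nondegeneracy.
\<close>

section \<open>Zeros of the part of top weighted degree\<close>

text \<open>Convex hulls commute with translation, and shifting a lattice point of the support by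
  \<open>r\<close> gives a generator of \<open>newton_polytope_plus a b\<close>.\<close>

lemma newton_polytope_add_quadrant:
  assumes "x \<in> newton_polytope a b" "r $ 1 \<ge> 0" "r $ 2 \<ge> 0"
  shows "x + r \<in> newton_polytope_plus a b"
proof -
  have "r + x \<in> (+) r ` newton_polytope a b"
    using assms(1) by blast
  also have "\<dots> = convex hull ((+) r ` lattice_point ` support a b)"
    by (simp add: newton_polytope_def convex_hull_translation)
  also have "\<dots> \<subseteq> newton_polytope_plus a b"
    unfolding newton_polytope_plus_def
    by (intro hull_mono) (use assms in \<open>force simp: add.commute\<close>)
  finally show ?thesis by (simp add: add.commute)
qed

lemma newton_polytope_subset_plus: "newton_polytope a b \<subseteq> newton_polytope_plus a b"
  using newton_polytope_add_quadrant[of _ a b 0] by auto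

lemma inner_vector_2: "(vector [c, d] :: plane) \<bullet> x = c * x $ 1 + d * x $ 2"
  by (simp add: inner_vec_def sum_2)

text \<open>A line supporting \<open>\<P>\<^sub>+\<close> at a relative interior point of the top edge has to contain that edge,
  and its normal has nonnegative entries because \<open>\<P>\<^sub>+\<close> absorbs the quadrant. So \<open>w\<close> would be minimal
  there on \<open>\<P>\<close>, whereas it is maximal.\<close>

lemma rel_interior_top_edge_not_frontier_plus:
  fixes a b :: coeffs and w :: plane and \<delta> :: real
  defines "F \<equiv> newton_polytope a b \<inter> {x. w \<bullet> x = \<delta>}"
  assumes pos: "w $ 1 > 0" "w $ 2 > 0"
    and le: "\<And>x. x \<in> newton_polytope a b \<Longrightarrow> w \<bullet> x \<le> \<delta>"
    and int: "interior (newton_polytope a b) \<noteq> {}"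
    and q: "q1 \<in> F" "q2 \<in> F" "q1 \<noteq> q2"
    and p: "p \<in> rel_interior F"
  shows "p \<notin> frontier (newton_polytope_plus a b)"
proof
  define P Q where "P = newton_polytope a b" and "Q = newton_polytope_plus a b"
  have PQ: "P \<subseteq> Q" and F: "F \<subseteq> Q"
    using newton_polytope_subset_plus[of a b] by (auto simp: P_def Q_def F_def)
  have convQ: "convex Q"
    by (simp add: Q_def newton_polytope_plus_def convex_convex_hull)
  have pF: "p \<in> F"
    using p rel_interior_subset by blast
  have intQ: "interior P \<subseteq> interior Q"
    using PQ interior_mono by blast
  with int have ri: "rel_interior Q = interior Q"
    by (metis P_def rel_interior_nonempty_interior subset_empty)
  assume "p \<in> frontier (newton_polytope_plus a b)"
  then have "p \<notin> rel_interior Q"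
    using ri by (simp add: frontier_def Q_def)
  then obtain c where c: "\<And>y. y \<in> Q \<Longrightarrow> c \<bullet> p \<le> c \<bullet> y" "\<And>y. y \<in> rel_interior Q \<Longrightarrow> c \<bullet> p < c \<bullet> y"
    using supporting_hyperplane_rel_boundary[OF convQ] pF F by (metis subsetD)
  have "(Q \<inter> {x. c \<bullet> x = c \<bullet> p}) face_of Q"
    by (rule face_of_Int_supporting_hyperplane_ge[OF convQ]) (use c in auto)
  then have "F \<subseteq> Q \<inter> {x. c \<bullet> x = c \<bullet> p}"
    by (rule subset_of_face_of) (use F p pF in \<open>auto simp: disjnt_def\<close>)
  then have "c \<bullet> q1 = c \<bullet> p" "c \<bullet> q2 = c \<bullet> p"
    using q(1,2) by (simp_all add: subset_iff)
  then have "c \<bullet> (q1 - q2) = 0"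
    by (simp add: inner_diff_right)
  moreover have "w \<bullet> (q1 - q2) = 0"
    using q by (auto simp: F_def inner_diff_right)
  ultimately have cw: "c $ 1 * (q1 - q2) $ 1 + c $ 2 * (q1 - q2) $ 2 = 0"
      "w $ 1 * (q1 - q2) $ 1 + w $ 2 * (q1 - q2) $ 2 = 0"
    by (simp_all add: inner_vec_def sum_2)
  have ne: "(q1 - q2) $ 1 \<noteq> 0 \<or> (q1 - q2) $ 2 \<noteq> 0"
    using q(3) by (auto simp: vec_eq_iff forall_2)
  \<comment> \<open>Both \<open>c\<close> and \<open>w\<close> are orthogonal to the nonzero plane
    vector \<open>q1 - q2\<close>, hence parallel.\<close>
  have "c $ 1 * w $ 2 = c $ 2 * w $ 1"
  proof -
    have "(c $ 1 * w $ 2 - c $ 2 * w $ 1) * (q1 - q2) $ 1 = 0"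
         "(c $ 1 * w $ 2 - c $ 2 * w $ 1) * (q1 - q2) $ 2 = 0"
      using cw by algebra+
    with ne show ?thesis by auto
  qed
  then have "c = (c $ 1 / w $ 1) *\<^sub>R w"
    using pos by (auto simp: vec_eq_iff forall_2 field_simps)
  moreover have "c $ 1 \<ge> 0"
  proof -
    have "p + axis 1 1 \<in> Q"
      unfolding Q_def
      by (rule newton_polytope_add_quadrant) (use pF in \<open>auto simp: F_def axis_def\<close>)
    then have "c \<bullet> p \<le> c \<bullet> (p + axis 1 1)" by (rule c)
    then show ?thesis by (simp add: inner_add_right inner_axis)
  qed
  ultimately obtain k where k: "c = k *\<^sub>R w" "k \<ge> 0"
    using pos by (metis divide_nonneg_pos)
  \<comment> \<open>At an interior point the supporting inequality is strict, which contradicts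
    maximality of \<open>w\<close> at \<open>p\<close> for every \<open>k \<ge> 0\<close>, including
    \<open>k = 0\<close>.\<close>
  obtain y where y: "y \<in> interior P"
    using int by (auto simp: P_def)
  then have "c \<bullet> p < c \<bullet> y"
    using c(2) intQ ri by blast
  moreover have "w \<bullet> y \<le> w \<bullet> p"
    using le[of y] y pF interior_subset by (auto simp: F_def P_def)
  ultimately show False
    using k by (simp add: mult_left_mono leD)
qed

text \<open>The points of \<open>P\<close> where \<open>w\<close> is maximal form a face inside a
  line; two distinct points make it one-dimensional. If \<open>P\<close> has interior, the relative
  interior of this edge avoids the frontier of the hull enlarged by the quadrant.\<close>

lemma top_edge_upper_segment:
  fixes a b :: coeffs and w :: plane and \<delta> :: real
  defines "F \<equiv> newton_polytope a b \<inter> {x. w \<bullet> x = \<delta>}"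
  assumes pos: "w $ 1 > 0" "w $ 2 > 0"
    and le: "\<And>x. x \<in> newton_polytope a b \<Longrightarrow> w \<bullet> x \<le> \<delta>"
    and q: "q1 \<in> F" "q2 \<in> F" "q1 \<noteq> q2"
  shows "upper_segment a b F"
proof -
  define P where "P = newton_polytope a b"
  have convP: "convex P"
    by (simp add: P_def newton_polytope_def convex_convex_hull)
  have face: "F face_of P"
    unfolding F_def P_def
    by (rule face_of_Int_supporting_hyperplane_le) (use convP le in \<open>auto simp: P_def\<close>)
  have w0: "w \<noteq> 0"
    using pos by auto
  have "aff_dim F \<le> aff_dim {x. w \<bullet> x = \<delta>}"
    by (rule aff_dim_subset) (auto simp: F_def)
  also have "\<dots> = 1"
    using w0 by (simp add: aff_dim_hyperplane)
  finally have dim_le: "aff_dim F \<le> 1" .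
  have "aff_dim {q1, q2} \<le> aff_dim F"
    by (rule aff_dim_subset) (use q in auto)
  with q dim_le have edge: "F edge_of P"
    using face by (simp add: edge_of_def)
  have "F \<subseteq> upper_boundary a b"
  proof (cases "interior P = {}")
    case True
    then show ?thesis
      by (simp add: upper_boundary_def P_def F_def)
  next
    case False
    have "F \<noteq> P"
    proof
      assume "F = P"
      then have "aff_dim P \<le> 1" using dim_le by simp
      moreover have "aff_dim P = 2"
        using False by (simp add: aff_dim_nonempty_interior)
      ultimately show False by simp
    qed
    then have "F \<inter> interior P = {}"
      using face face_of_disjoint_interior by blast
    moreover have "F \<subseteq> closure P"
      using closure_subset[of P] by (auto simp: F_def P_def)
    ultimately have "F \<subseteq> frontier P"
      by (auto simp: frontier_def)
    then have sub: "rel_interior F \<subseteq> frontier P - frontier (newton_polytope_plus a b)"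
      using rel_interior_top_edge_not_frontier_plus[OF pos le] False q rel_interior_subset
      unfolding F_def P_def by blast
    have "convex F"
      using face face_of_imp_convex convP by blast
    \<comment> \<open>The endpoints of \<open>F\<close> may lie on the removed frontier; the closure
      in \<open>upper_boundary\<close> restores them.\<close>
    then have "F \<subseteq> closure (rel_interior F)"
      by (simp add: convex_closure_rel_interior closure_subset)
    with sub False show ?thesis
      using closure_mono[OF sub] by (auto simp: upper_boundary_def P_def)
  qed
  with edge show ?thesis
    by (simp add: upper_segment_def P_def)
qed

section \<open>Fields restricted to the lattice points of top weight\<close>

lemma field_on_nth:
  "field_on a b T p $ 1 = (\<Sum>(m, n)\<in>support a b \<inter> T. a m n * (p $ 1) powi (m + 1) * (p $ 2) powi n)"
  "field_on a b T p $ 2 = (\<Sum>(m, n)\<in>support a b \<inter> T. b m n * (p $ 1) powi m * (p $ 2) powi (n + 1))"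
  by (simp_all add: field_on_def case_prod_unfold)

lemma field_on_cong: "support a b \<inter> S = support a b \<inter> T \<Longrightarrow> field_on a b S = field_on a b T"
  by (simp add: field_on_def fun_eq_iff)

text \<open>Handles a maximum attained at a single vertex, where nondegeneracy, a condition on
  segments, gives no information: one monomial term with a nonzero coefficient cannot vanish off the
  axes.\<close>

lemma field_on_singleton_nonzero:
  assumes "support a b \<inter> T = {s}" "p $ 1 \<noteq> 0" "p $ 2 \<noteq> 0"
  shows "field_on a b T p \<noteq> 0"
proof -
  have "s \<in> support a b"
    using assms(1) by blast
  then have "a (fst s) (snd s) \<noteq> 0 \<or> b (fst s) (snd s) \<noteq> 0"
    by (auto simp: support_def)
  then have "field_on a b T p $ 1 \<noteq> 0 \<or> field_on a b T p $ 2 \<noteq> 0"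
    unfolding field_on_nth assms(1) using assms(2,3) by (auto simp: case_prod_unfold)
  then show ?thesis by auto
qed

lemma lattice_point_inj: "lattice_point s = lattice_point t \<Longrightarrow> s = t"
  by (simp add: vec_eq_iff forall_2 prod_eq_iff)

lemma weighted_degree_ge:
  assumes "finite (support a b)" "s \<in> support a b"
  shows "int \<alpha> * fst s + int \<beta> * snd s \<le> weighted_degree a b \<alpha> \<beta>"
  unfolding weighted_degree_def
  by (rule Max_ge) (use assms in \<open>force simp: case_prod_unfold\<close>)+

lemma weighted_degree_attained:
  assumes "finite (support a b)" "support a b \<noteq> {}"
  shows "\<exists>s\<in>support a b. int \<alpha> * fst s + int \<beta> * snd s = weighted_degree a b \<alpha> \<beta>"
proof -
  have "weighted_degree a b \<alpha> \<beta> \<in> (\<lambda>(m, n). int \<alpha> * m + int \<beta> * n) ` support a b"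
    unfolding weighted_degree_def by (rule Max_in) (use assms in auto)
  then show ?thesis by (force simp: case_prod_unfold)
qed

text \<open>Either one support point has top weight and a single term remains, or two do and the
  maximal face is an upper segment, to which nondegeneracy applies.\<close>

lemma top_part_nonzero:
  assumes fin: "finite (support a b)" and ne: "support a b \<noteq> {}"
    and nondeg: "upper_part_nondegenerate a b"
    and pos: "\<alpha> > 0" "\<beta> > 0"
    and p: "p $ 1 \<noteq> 0" "p $ 2 \<noteq> 0"
  shows "field_on a b {(m, n). int \<alpha> * m + int \<beta> * n = weighted_degree a b \<alpha> \<beta>} p \<noteq> 0"
    (is "field_on a b ?T p \<noteq> 0")
proof -
  define D where "D = weighted_degree a b \<alpha> \<beta>"
  define w :: plane where "w = vector [real \<alpha>, real \<beta>]"
  define F where "F = newton_polytope a b \<inter> {x. w \<bullet> x = of_int D}"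
  have w_lattice: "w \<bullet> lattice_point s = of_int (int \<alpha> * fst s + int \<beta> * snd s)" for s
    by (simp add: w_def inner_vector_2)
  have "newton_polytope a b \<subseteq> {x. w \<bullet> x \<le> of_int D}"
    unfolding newton_polytope_def
  proof (rule hull_minimal)
    show "lattice_point ` support a b \<subseteq> {x. w \<bullet> x \<le> of_int D}"
      by (intro image_subsetI)
        (simp only: mem_Collect_eq w_lattice of_int_le_iff D_def weighted_degree_ge[OF fin])
  qed (rule convex_halfspace_le)
  then have le: "w \<bullet> x \<le> of_int D" if "x \<in> newton_polytope a b" for x
    using that by auto
  have w_pos: "w $ 1 > 0" "w $ 2 > 0"
    using pos by (simp_all add: w_def)
  \<comment> \<open>Translates between the real face \<open>F\<close> and the integer equation
    defining the top part.\<close>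
  have in_F: "lattice_point s \<in> F \<longleftrightarrow> s \<in> ?T" if "s \<in> support a b" for s
  proof -
    have "lattice_point s \<in> newton_polytope a b"
      using that by (auto simp: newton_polytope_def intro: hull_inc)
    then show ?thesis
      by (auto simp: F_def w_lattice D_def simp del: of_int_add of_int_mult)
  qed
  obtain s where s: "s \<in> support a b \<inter> ?T"
    using weighted_degree_attained[OF fin ne] by (force simp: case_prod_unfold)
  show ?thesis
  proof (cases "support a b \<inter> ?T = {s}")
    case True
    then show ?thesis
      using field_on_singleton_nonzero p by blast
  next
    case False
    with s obtain t where t: "t \<in> support a b \<inter> ?T" "t \<noteq> s"
      by blast
    have "upper_segment a b F"
      unfolding F_def
    proof (rule top_edge_upper_segment[OF w_pos le])
      show "lattice_point s \<in> newton_polytope a b \<inter> {x. w \<bullet> x = of_int D}"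
           "lattice_point t \<in> newton_polytope a b \<inter> {x. w \<bullet> x = of_int D}"
        using s t in_F unfolding F_def by blast+
      show "lattice_point s \<noteq> lattice_point t"
        using t lattice_point_inj by metis
    qed
    with nondeg p have "field_on a b {s. lattice_point s \<in> F} p \<noteq> 0"
      by (simp add: upper_part_nondegenerate_def)
    moreover have "field_on a b {s. lattice_point s \<in> F} = field_on a b ?T"
      by (rule field_on_cong) (use in_F in blast)
    ultimately show ?thesis
      by simp
  qed
qed

section \<open>Singularities at infinity of a compactified field\<close>

lemma has_derivative_vec_nth: "((\<lambda>q. q $ i) has_derivative (\<lambda>h. h $ i)) (at q)"
  by (rule bounded_linear_imp_has_derivative) (rule bounded_linear_vec_nth)

lemma has_derivative_vector_2:
  fixes f g :: "'a::real_normed_vector \<Rightarrow> real"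
  assumes "(f has_derivative f') (at x within S)" "(g has_derivative g') (at x within S)"
  shows "((\<lambda>p. vector [f p, g p] :: real^2) has_derivative (\<lambda>h. vector [f' h, g' h])) (at x within S)"
proof -
  have *: "(vector [c, d] :: real^2) = c *\<^sub>R axis 1 1 + d *\<^sub>R axis 2 1" for c d :: real
    by (auto simp: vec_eq_iff forall_2 axis_def)
  show ?thesis
    unfolding * by (intro derivative_intros assms)
qed

lemma jacobian_eqI:
  fixes f :: "real^'n \<Rightarrow> real^'m"
  assumes "(f has_derivative (\<lambda>h. M *v h)) (at p)"
  shows "jacobian f (at p) = M"
  unfolding jacobian_def frechet_derivative_at[OF assms, symmetric] by (rule matrix_of_matrix_vector_mul)

text \<open>Lets a guessed field \<open>w\<close> be verified by pushing it forward with
  \<open>M\<close>, so that no inverse matrix is computed.\<close>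

lemma change_of_variables_eqI:
  assumes der: "(\<phi> has_derivative (\<lambda>h. M *v h)) (at p)"
    and "invertible M" and w: "M *v w = X (\<phi> p)"
  shows "change_of_variables \<phi> X p = w"
proof -
  have "matrix_inv M ** M = mat 1"
    using \<open>invertible M\<close> unfolding matrix_inv_def invertible_def by (metis (mono_tags, lifting) someI_ex)
  then have "matrix_inv M *v (M *v w) = w"
    by (simp add: matrix_vector_mul_assoc)
  then show ?thesis
    by (simp add: change_of_variables_def jacobian_eqI[OF der] w)
qed

lemma eigenvalue_upper_triangular:
  fixes A :: "real^2^2"
  assumes "A $ 2 $ 1 = 0"
  shows "eigenvalue A c \<longleftrightarrow> c = of_real (A $ 1 $ 1) \<or> c = of_real (A $ 2 $ 2)"
proof -
  define r s t where "r = complex_of_real (A $ 1 $ 1)" and "s = complex_of_real (A $ 1 $ 2)"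
    and "t = complex_of_real (A $ 2 $ 2)"
  have eq: "map_matrix complex_of_real A *v w = c *s w \<longleftrightarrow>
      r * w $ 1 + s * w $ 2 = c * w $ 1 \<and> t * w $ 2 = c * w $ 2" for w
    using assms
    by (simp add: vec_eq_iff forall_2 matrix_vector_mult_def sum_2 map_matrix_def r_def s_def t_def)
  have "eigenvalue A c \<longleftrightarrow> c = r \<or> c = t"
  proof
    assume "eigenvalue A c"
    then obtain w where "w \<noteq> 0" "map_matrix complex_of_real A *v w = c *s w"
      unfolding eigenvalue_def by blast
    then have w: "w \<noteq> 0" "r * w $ 1 + s * w $ 2 = c * w $ 1" "t * w $ 2 = c * w $ 2"
      unfolding eq by simp_all
    show "c = r \<or> c = t"
    proof (cases "w $ 2 = 0")
      case True
      with w(1) have "w $ 1 \<noteq> 0" by (auto simp: vec_eq_iff forall_2)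
      with w(2) True show ?thesis by simp
    qed (use w(3) in auto)
  next
    assume c: "c = r \<or> c = t"
    show "eigenvalue A c"
    proof (cases "c = r")
      case True
      then show ?thesis
        unfolding eigenvalue_def eq by (intro exI[of _ "vector [1, 0]"]) (simp add: vec_eq_iff forall_2)
    next
      case False
      with c have "c = t" by simp
      \<comment> \<open>\<open>[s, t - r]\<close> is an eigenvector for \<open>t\<close> because
        \<open>r * s + s * (t - r) = t * s\<close>; it is nonzero since
        \<open>t \<noteq> r\<close>.\<close>
      with False show ?thesis
        unfolding eigenvalue_def eq
        by (intro exI[of _ "vector [s, t - r]"]) (simp add: vec_eq_iff forall_2 algebra_simps)
    qed
  qed
  then show ?thesis by (simp add: r_def t_def)
qed

text \<open>The eigenvalues are the real diagonal entries, and the second is nonzero; whether the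
  first vanishes decides between the two alternatives.\<close>

lemma hyperbolic_or_semi_hyperbolic_upper_triangular:
  assumes "jacobian Y (at p) $ 2 $ 1 = 0" "jacobian Y (at p) $ 2 $ 2 \<noteq> 0"
  shows "hyperbolic Y p \<or> semi_hyperbolic Y p"
proof -
  define r t where "r = jacobian Y (at p) $ 1 $ 1" and "t = jacobian Y (at p) $ 2 $ 2"
  have eig: "eigenvalue (jacobian Y (at p)) c \<longleftrightarrow> c = of_real r \<or> c = of_real t" for c
    unfolding r_def t_def by (rule eigenvalue_upper_triangular) (rule assms)
  have t: "t \<noteq> 0"
    using assms(2) by (simp add: t_def)
  show ?thesis
  proof (cases "r = 0")
    case True
    with t have "semi_hyperbolic Y p"
      unfolding semi_hyperbolic_def eig by (intro conjI ex1I[of _ "of_real t"]) auto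
    then show ?thesis ..
  next
    case False
    with t have "hyperbolic Y p"
      unfolding hyperbolic_def eig by auto
    then show ?thesis ..
  qed
qed

text \<open>On \<open>v = 0\<close> the field is \<open>(u * (G - r * F), 0)\<close> and the second eigenvalue of its Jacobian is
  \<open>t * F\<close>; hence a singularity with \<open>F = 0\<close> would also have \<open>G = 0\<close>.\<close>

lemma compactified_at_infinity:
  fixes S :: "'i set" and f g :: "'i \<Rightarrow> real" and k :: "'i \<Rightarrow> int" and d :: "'i \<Rightarrow> nat"
  defines "F \<equiv> \<lambda>q::plane. \<Sum>s\<in>S. f s * (q $ 1) powi k s * (q $ 2) ^ d s"
    and "G \<equiv> \<lambda>q::plane. \<Sum>s\<in>S. g s * (q $ 1) powi k s * (q $ 2) ^ d s"
  assumes fin: "finite S" and u: "u \<noteq> 0" and t: "t \<noteq> 0"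
    and off: "\<And>q. q $ 1 \<noteq> 0 \<Longrightarrow> q $ 2 \<noteq> 0 \<Longrightarrow>
      (q $ 2) powi D *\<^sub>R change_of_variables \<phi> X q = vector [q $ 1 * (G q - r * F q), q $ 2 * (t * F q)]"
    and sing: "singularity (compactified \<phi> D X) (vector [u, 0])"
    and top: "(\<Sum>s | s \<in> S \<and> d s = 0. f s * u powi k s) \<noteq> 0 \<or>
              (\<Sum>s | s \<in> S \<and> d s = 0. g s * u powi k s) \<noteq> 0"
  shows "hyperbolic (compactified \<phi> D X) (vector [u, 0]) \<or>
         semi_hyperbolic (compactified \<phi> D X) (vector [u, 0])"
proof -
  define C where "C = (\<lambda>q. q $ 1 * (G q - r * F q))"
  define E where "E = (\<lambda>q. t * F q)"
  \<comment> \<open>\<open>Z\<close> is the right-hand side of \<open>off\<close>, read also on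
    \<open>q $ 2 = 0\<close>; the natural exponents \<open>d s\<close> keep it differentiable there
    as long as \<open>q $ 1 \<noteq> 0\<close>.\<close>
  define Z where "Z = (\<lambda>q::plane. vector [C q, q $ 2 * E q] :: plane)"
  define p :: plane where "p = vector [u, 0]"
  define Y where "Y = compactified \<phi> D X"
  have "(\<lambda>q. \<Sum>s\<in>S. h s * (q $ 1) powi k s * (q $ 2) ^ d s) differentiable (at q)"
    if "q $ 1 \<noteq> 0" for q :: plane and h
    unfolding differentiable_def
    by (rule exI has_derivative_sum has_derivative_mult has_derivative_const
        has_derivative_power_int has_derivative_power has_derivative_vec_nth that)+
  then have F': "(F has_derivative frechet_derivative F (at q)) (at q)"
    and G': "(G has_derivative frechet_derivative G (at q)) (at q)" if "q $ 1 \<noteq> 0" for q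
    using that unfolding F_def G_def by (simp_all flip: frechet_derivative_works)
  define C' where "C' = (\<lambda>q h. q $ 1 * (frechet_derivative G (at q) h - r * frechet_derivative F (at q) h) +
      h $ 1 * (G q - r * F q))"
  define E' where "E' = (\<lambda>q h. t * frechet_derivative F (at q) h)"
  have C': "(C has_derivative C' q) (at q)" and E': "(E has_derivative E' q) (at q)" if "q $ 1 \<noteq> 0" for q
    unfolding C_def C'_def E_def E'_def
    by (intro has_derivative_mult has_derivative_diff has_derivative_mult_right has_derivative_vec_nth F' G' that)+
  have Z': "(Z has_derivative (\<lambda>h. vector [C' q h, q $ 2 * E' q h + h $ 2 * E q])) (at q)"
    if "q $ 1 \<noteq> 0" for q
    unfolding Z_def by (intro has_derivative_vector_2 has_derivative_mult has_derivative_vec_nth C' E' that)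
  have Y_eq: "Y q = Z q" if q: "q $ 1 \<noteq> 0" for q
  proof (cases "q $ 2 = 0")
    case False
    then show ?thesis
      using off[OF q] by (simp add: Y_def compactified_def Z_def C_def E_def)
  next
    case True
    let ?V = "{q::plane. q $ 2 \<noteq> 0}"
    have "isCont Z q"
      using Z'[OF q] by (rule has_derivative_continuous)
    then have "(Z \<longlongrightarrow> Z q) (at q within ?V)"
      by (simp add: continuous_at_imp_continuous_at_within flip: continuous_within)
    moreover have "eventually (\<lambda>r. Z r = (r $ 2) powi D *\<^sub>R change_of_variables \<phi> X r) (at q within ?V)"
    proof -
      have "open {r::plane. r $ 1 \<noteq> 0}"
        by (intro open_Collect_neq continuous_intros)
      then show ?thesis
        unfolding eventually_at_topological using off q
        by (intro exI[of _ "{r. r $ 1 \<noteq> 0}"]) (auto simp: Z_def C_def E_def)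
    qed
    ultimately have "((\<lambda>r. (r $ 2) powi D *\<^sub>R change_of_variables \<phi> X r) \<longlongrightarrow> Z q) (at q within ?V)"
      using tendsto_cong by fast
    \<comment> \<open>\<open>Lim\<close> is determined only along a nontrivial filter; vertical
      displacements of \<open>q\<close> approach it from off the line.\<close>
    moreover have "at q within ?V \<noteq> bot"
    proof -
      have "q islimpt ?V"
        unfolding islimpt_approachable
      proof (intro allI impI)
        fix \<epsilon> :: real assume "\<epsilon> > 0"
        then show "\<exists>r\<in>?V. r \<noteq> q \<and> dist r q < \<epsilon>"
          using True by (intro bexI[of _ "q + (\<epsilon> / 2) *\<^sub>R axis 2 1"]) (auto simp: dist_norm axis_eq_0_iff)
      qed
      then show ?thesis
        by (simp add: trivial_limit_within)
    qed
    ultimately show ?thesis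
      using True by (simp add: Y_def compactified_def tendsto_Lim)
  qed
  have p: "p $ 1 \<noteq> 0" "p $ 2 = 0"
    using u by (simp_all add: p_def)
  have "(Y has_derivative (\<lambda>h. vector [C' p h, p $ 2 * E' p h + h $ 2 * E p])) (at p)"
    by (rule has_derivative_transform_within_open[OF Z'[OF p(1)], of "{r. r $ 1 \<noteq> 0}"])
      (use p Y_eq in \<open>auto intro!: open_Collect_neq continuous_intros\<close>)
  \<comment> \<open>Since \<open>p $ 2 = 0\<close>, the term with \<open>E'\<close> disappears and
    the second row of the Jacobian is \<open>(0, E p)\<close>.\<close>
  then have "frechet_derivative Y (at p) = (\<lambda>h. vector [C' p h, h $ 2 * E p])"
    using frechet_derivative_at p(2) by force
  then have jac: "jacobian Y (at p) $ 2 $ 1 = 0" "jacobian Y (at p) $ 2 $ 2 = E p"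
    by (simp_all add: jacobian_def matrix_def axis_def)
  \<comment> \<open>As \<open>0 ^ 0 = 1\<close>, precisely the terms with \<open>d s = 0\<close>
    survive at infinity.\<close>
  have drop: "(\<Sum>s\<in>S. g s * 0 ^ d s) = (\<Sum>s | s \<in> S \<and> d s = 0. g s)" for g :: "'i \<Rightarrow> real"
    using fin by (intro sum.mono_neutral_cong_right) auto
  have "C p = 0"
    using sing Y_eq[OF p(1)] by (simp add: singularity_def Y_def p_def Z_def vec_eq_iff forall_2)
  then have "G p = r * F p"
    using p by (simp add: C_def)
  \<comment> \<open>If \<open>E p = t * F p\<close> were zero, then \<open>F p\<close> and hence
    \<open>G p = r * F p\<close> would vanish, against \<open>top\<close>.\<close>
  then have "E p \<noteq> 0"
    using top t unfolding E_def F_def G_def p_def by (auto simp: drop)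
  with jac show ?thesis
    unfolding Y_def p_def by (intro hyperbolic_or_semi_hyperbolic_upper_triangular) auto
qed

section \<open>The four charts\<close>

text \<open>Splitting \<open>x powi (m + 1)\<close> into \<open>x * x powi m\<close> is valid for
  \<open>x \<noteq> 0\<close>; at \<open>x = 0\<close> it fails for \<open>m = -1\<close>.\<close>

lemma field_on_off_axes:
  assumes "p $ 1 \<noteq> 0" "p $ 2 \<noteq> 0"
  shows "field_on a b T p =
    vector [p $ 1 * (\<Sum>(m, n)\<in>support a b \<inter> T. a m n * ((p $ 1) powi m * (p $ 2) powi n)),
            p $ 2 * (\<Sum>(m, n)\<in>support a b \<inter> T. b m n * ((p $ 1) powi m * (p $ 2) powi n))]"
  using assms
  by (auto simp: vec_eq_iff forall_2 field_on_nth sum_distrib_left case_prod_unfold power_int_add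
      intro!: sum.cong)

lemma invertible_2I:
  fixes M :: "real^2^2"
  assumes "M $ 1 $ 1 * M $ 2 $ 2 - M $ 1 $ 2 * M $ 2 $ 1 \<noteq> 0"
  shows "invertible M"
  using assms by (simp add: invertible_det_nz det_2)

text \<open>Differentiating \<open>x = \<sigma> * v powi (- \<alpha>)\<close> and using
  \<open>x' = x * A\<close> gives \<open>v' = - v * A / \<alpha>\<close>; inserting this into the
  derivative of \<open>y = u * v powi (- \<beta>)\<close> with \<open>y' = y * B\<close> gives
  \<open>u'\<close>.\<close>

lemma change_of_variables_chart_x:
  assumes pos: "\<alpha> > 0" and \<sigma>: "\<sigma> \<noteq> 0" and v: "q $ 2 \<noteq> 0"
    and X: "X (chart_x \<sigma> \<alpha> \<beta> q) = vector [chart_x \<sigma> \<alpha> \<beta> q $ 1 * A, chart_x \<sigma> \<alpha> \<beta> q $ 2 * B]"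
  shows "change_of_variables (chart_x \<sigma> \<alpha> \<beta>) X q =
    vector [q $ 1 * (B - real \<beta> / real \<alpha> * A), q $ 2 * (- A / real \<alpha>)]"
proof -
  define u v where "u = q $ 1" and "v = q $ 2"
  define M :: "real^2^2" where
    "M = vector [vector [0, - (\<sigma> * real \<alpha> * v powi (- int \<alpha> - 1))],
                 vector [v powi (- int \<beta>), - (u * real \<beta> * v powi (- int \<beta> - 1))]]"
  have v0: "v \<noteq> 0" using v by (simp add: v_def)
  \<comment> \<open>The action of \<open>M\<close> in the shape that the product and power rules
    produce.\<close>
  have M: "(\<lambda>h. M *v h) = (\<lambda>h. vector [\<sigma> * (h $ 2 * (of_int (- int \<alpha>) * v powi (- int \<alpha> - 1))),
      u * (h $ 2 * (of_int (- int \<beta>) * v powi (- int \<beta> - 1))) + h $ 1 * v powi (- int \<beta>)])"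
    by (auto simp: fun_eq_iff vec_eq_iff forall_2 matrix_vector_mult_def sum_2 M_def algebra_simps)
  show ?thesis
  proof (rule change_of_variables_eqI)
    show "(chart_x \<sigma> \<alpha> \<beta> has_derivative (\<lambda>h. M *v h)) (at q)"
      unfolding M chart_x_def u_def v_def
      by (intro has_derivative_vector_2 has_derivative_mult has_derivative_power_int
          has_derivative_mult_right has_derivative_vec_nth v)
    \<comment> \<open>The determinant is
      \<open>\<sigma> * \<alpha> * v powi (- \<alpha> - \<beta> - 1)\<close>.\<close>
    show "invertible M"
      by (rule invertible_2I) (use pos \<sigma> v0 in \<open>simp add: M_def\<close>)
    show "M *v vector [q $ 1 * (B - real \<beta> / real \<alpha> * A), q $ 2 * (- A / real \<alpha>)] = X (chart_x \<sigma> \<alpha> \<beta> q)"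
      using pos v0 unfolding X
      by (simp add: vec_eq_iff forall_2 matrix_vector_mult_def sum_2 M_def chart_x_def power_int_diff
          field_simps flip: u_def v_def)
  qed
qed

text \<open>The same computation with the two coordinates and weights exchanged: now
  \<open>B\<close> determines \<open>v'\<close>.\<close>

lemma change_of_variables_chart_y:
  assumes pos: "\<beta> > 0" and \<sigma>: "\<sigma> \<noteq> 0" and v: "q $ 2 \<noteq> 0"
    and X: "X (chart_y \<sigma> \<alpha> \<beta> q) = vector [chart_y \<sigma> \<alpha> \<beta> q $ 1 * A, chart_y \<sigma> \<alpha> \<beta> q $ 2 * B]"
  shows "change_of_variables (chart_y \<sigma> \<alpha> \<beta>) X q =
    vector [q $ 1 * (A - real \<alpha> / real \<beta> * B), q $ 2 * (- B / real \<beta>)]"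
proof -
  define u v where "u = q $ 1" and "v = q $ 2"
  define M :: "real^2^2" where
    "M = vector [vector [v powi (- int \<alpha>), - (u * real \<alpha> * v powi (- int \<alpha> - 1))],
                 vector [0, - (\<sigma> * real \<beta> * v powi (- int \<beta> - 1))]]"
  have v0: "v \<noteq> 0" using v by (simp add: v_def)
  have M: "(\<lambda>h. M *v h) = (\<lambda>h. vector [
      u * (h $ 2 * (of_int (- int \<alpha>) * v powi (- int \<alpha> - 1))) + h $ 1 * v powi (- int \<alpha>),
      \<sigma> * (h $ 2 * (of_int (- int \<beta>) * v powi (- int \<beta> - 1)))])"
    by (auto simp: fun_eq_iff vec_eq_iff forall_2 matrix_vector_mult_def sum_2 M_def algebra_simps)
  show ?thesis
  proof (rule change_of_variables_eqI)
    show "(chart_y \<sigma> \<alpha> \<beta> has_derivative (\<lambda>h. M *v h)) (at q)"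
      unfolding M chart_y_def u_def v_def
      by (intro has_derivative_vector_2 has_derivative_mult has_derivative_power_int
          has_derivative_mult_right has_derivative_vec_nth v)
    show "invertible M"
      by (rule invertible_2I) (use pos \<sigma> v0 in \<open>simp add: M_def\<close>)
    show "M *v vector [q $ 1 * (A - real \<alpha> / real \<beta> * B), q $ 2 * (- B / real \<beta>)] = X (chart_y \<sigma> \<alpha> \<beta> q)"
      using pos v0 unfolding X
      by (simp add: vec_eq_iff forall_2 matrix_vector_mult_def sum_2 M_def chart_y_def power_int_diff
          field_simps flip: u_def v_def)
  qed
qed

text \<open>The total exponent of \<open>v\<close> is the gap between \<open>D\<close> and the
  weight of \<open>(m, n)\<close>. It is nonnegative, so the monomial extends to
  \<open>v = 0\<close>.\<close>

lemma chart_monomial: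
  fixes u v \<sigma> :: real
  assumes "v \<noteq> 0" "int \<alpha> * m + int \<beta> * n \<le> D"
  shows "v powi D * ((\<sigma> * v powi (- int \<alpha>)) powi m * (u * v powi (- int \<beta>)) powi n) =
         \<sigma> powi m * u powi n * v ^ nat (D - int \<alpha> * m - int \<beta> * n)"
proof -
  have "v powi D * ((\<sigma> * v powi (- int \<alpha>)) powi m * (u * v powi (- int \<beta>)) powi n) =
      \<sigma> powi m * u powi n * (v powi D * v powi (- int \<alpha> * m) * v powi (- int \<beta> * n))"
    unfolding power_int_mult_distrib power_int_mult by (simp only: mult_ac)
  also have "v powi D * v powi (- int \<alpha> * m) * v powi (- int \<beta> * n) = v powi (D - int \<alpha> * m - int \<beta> * n)"
    using assms(1) by (simp flip: power_int_add)
  also have "\<dots> = v ^ nat (D - int \<alpha> * m - int \<beta> * n)"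
    using assms(2) by (simp add: power_int_def)
  finally show ?thesis .
qed

text \<open>Applies \<open>compactified_at_infinity\<close> with \<open>F\<close> built from the
  \<open>a\<close> coefficients, which drive \<open>v'\<close>. Its terms of exponent zero form the
  top part of the field evaluated at \<open>(\<sigma>, u)\<close>.\<close>

lemma singularity_chart_x:
  assumes X: "polynomial_vector_field X a b" and ne: "support a b \<noteq> {}"
    and nondeg: "upper_part_nondegenerate a b"
    and pos: "\<alpha> > 0" "\<beta> > 0" and \<sigma>: "\<sigma> \<noteq> 0" and u: "u \<noteq> 0"
    and sing: "singularity (compactified (chart_x \<sigma> \<alpha> \<beta>) (weighted_degree a b \<alpha> \<beta>) X) (vector [u, 0])"
  shows "hyperbolic (compactified (chart_x \<sigma> \<alpha> \<beta>) (weighted_degree a b \<alpha> \<beta>) X) (vector [u, 0]) \<or>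
    semi_hyperbolic (compactified (chart_x \<sigma> \<alpha> \<beta>) (weighted_degree a b \<alpha> \<beta>) X) (vector [u, 0])"
proof -
  define S D where "S = support a b" and "D = weighted_degree a b \<alpha> \<beta>"
  define a' b' where "a' = (\<lambda>s. a (fst s) (snd s))" and "b' = (\<lambda>s. b (fst s) (snd s))"
  \<comment> \<open>The exponent of \<open>v\<close>; by \<open>deg\<close> the conversion to
    \<open>nat\<close> truncates nothing on \<open>S\<close>, so \<open>d s = 0\<close> means top
    weight.\<close>
  define d where "d = (\<lambda>s. nat (D - int \<alpha> * fst s - int \<beta> * snd s))"
  have fin: "finite S" and X_eq: "X = field_on a b UNIV"
    using X by (auto simp: polynomial_vector_field_def S_def)
  have deg: "int \<alpha> * fst s + int \<beta> * snd s \<le> D" if "s \<in> S" for s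
    using weighted_degree_ge[OF fin[unfolded S_def] that[unfolded S_def], of \<alpha> \<beta>]
    by (simp add: D_def add.commute)
  show ?thesis
  proof (rule compactified_at_infinity[OF fin u _ _ sing, where f = "\<lambda>s. a' s * \<sigma> powi fst s"
        and g = "\<lambda>s. b' s * \<sigma> powi fst s" and k = snd and d = d
        and r = "real \<beta> / real \<alpha>" and t = "(- 1 / real \<alpha>)"], fold D_def)
    fix q :: plane assume q: "q $ 1 \<noteq> 0" "q $ 2 \<noteq> 0"
    define x y where "x = chart_x \<sigma> \<alpha> \<beta> q $ 1" and "y = chart_x \<sigma> \<alpha> \<beta> q $ 2"
    define A B where "A = (\<Sum>s\<in>S. a' s * (x powi fst s * y powi snd s))"
      and "B = (\<Sum>s\<in>S. b' s * (x powi fst s * y powi snd s))"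
    have xy: "x = \<sigma> * (q $ 2) powi (- int \<alpha>)" "y = q $ 1 * (q $ 2) powi (- int \<beta>)"
      by (simp_all add: x_def y_def chart_x_def)
    then have "x \<noteq> 0" "y \<noteq> 0" using \<sigma> q by auto
    then have "X (chart_x \<sigma> \<alpha> \<beta> q) = vector [x * A, y * B]"
      unfolding X_eq x_def y_def A_def B_def a'_def b'_def S_def
      by (subst field_on_off_axes) (simp_all add: case_prod_unfold)
    then have cov: "change_of_variables (chart_x \<sigma> \<alpha> \<beta>) X q = vector [q $ 1 * (B - real \<beta> / real \<alpha> * A), q $ 2 * (- A / real \<alpha>)]"
      using pos \<sigma> q unfolding x_def y_def by (intro change_of_variables_chart_x)
    have sum: "(q $ 2) powi D * (\<Sum>s\<in>S. h s * (x powi fst s * y powi snd s)) =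
        (\<Sum>s\<in>S. h s * \<sigma> powi fst s * (q $ 1) powi snd s * (q $ 2) ^ d s)" for h
      unfolding sum_distrib_left
    proof (intro sum.cong refl)
      fix s assume "s \<in> S"
      note chart_monomial[OF q(2) deg[OF this], of \<sigma> "q $ 1"]
      then have "(q $ 2) powi D * (x powi fst s * y powi snd s) =
          \<sigma> powi fst s * (q $ 1) powi snd s * (q $ 2) ^ d s"
        unfolding xy d_def by (simp only: mult_ac)
      then show "(q $ 2) powi D * (h s * (x powi fst s * y powi snd s)) =
          h s * \<sigma> powi fst s * (q $ 1) powi snd s * (q $ 2) ^ d s"
        by (simp only: mult_ac)
    qed
    show "(q $ 2) powi D *\<^sub>R change_of_variables (chart_x \<sigma> \<alpha> \<beta>) X q =
      vector [q $ 1 * ((\<Sum>s\<in>S. b' s * \<sigma> powi fst s * (q $ 1) powi snd s * (q $ 2) ^ d s) -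
                real \<beta> / real \<alpha> * (\<Sum>s\<in>S. a' s * \<sigma> powi fst s * (q $ 1) powi snd s * (q $ 2) ^ d s)),
              q $ 2 * ((- 1 / real \<alpha>) * (\<Sum>s\<in>S. a' s * \<sigma> powi fst s * (q $ 1) powi snd s * (q $ 2) ^ d s))]"
      unfolding cov sum[symmetric] A_def[symmetric] B_def[symmetric]
      by (simp add: vec_eq_iff forall_2 algebra_simps)
  next
    let ?T = "{s. s \<in> S \<and> d s = 0}"
    let ?p = "vector [\<sigma>, u] :: plane"
    have T: "support a b \<inter> {(m, n). int \<alpha> * m + int \<beta> * n = D} = ?T"
      using deg by (force simp: S_def d_def)
    \<comment> \<open>The point \<open>(\<sigma>, u)\<close> lies off both axes, so the top part
      cannot vanish there.\<close>
    have "field_on a b {(m, n). int \<alpha> * m + int \<beta> * n = D} ?p \<noteq> 0"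
      unfolding D_def by (rule top_part_nonzero[OF _ ne nondeg pos]) (use fin u \<sigma> in \<open>auto simp: S_def\<close>)
    then show "(\<Sum>s\<in>?T. a' s * \<sigma> powi fst s * u powi snd s) \<noteq> 0 \<or>
        (\<Sum>s\<in>?T. b' s * \<sigma> powi fst s * u powi snd s) \<noteq> 0"
      using u \<sigma> by (subst (asm) field_on_off_axes)
        (auto simp: T[unfolded case_prod_unfold] case_prod_unfold a'_def b'_def vec_eq_iff forall_2 mult_ac)
  qed (use pos in auto)
qed

text \<open>Here \<open>F\<close> is built from the \<open>b\<close> coefficients, and the top part
  is evaluated at \<open>(u, \<sigma>)\<close>.\<close>

lemma singularity_chart_y:
  assumes X: "polynomial_vector_field X a b" and ne: "support a b \<noteq> {}"
    and nondeg: "upper_part_nondegenerate a b"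
    and pos: "\<alpha> > 0" "\<beta> > 0" and \<sigma>: "\<sigma> \<noteq> 0" and u: "u \<noteq> 0"
    and sing: "singularity (compactified (chart_y \<sigma> \<alpha> \<beta>) (weighted_degree a b \<alpha> \<beta>) X) (vector [u, 0])"
  shows "hyperbolic (compactified (chart_y \<sigma> \<alpha> \<beta>) (weighted_degree a b \<alpha> \<beta>) X) (vector [u, 0]) \<or>
    semi_hyperbolic (compactified (chart_y \<sigma> \<alpha> \<beta>) (weighted_degree a b \<alpha> \<beta>) X) (vector [u, 0])"
proof -
  define S D where "S = support a b" and "D = weighted_degree a b \<alpha> \<beta>"
  define a' b' where "a' = (\<lambda>s. a (fst s) (snd s))" and "b' = (\<lambda>s. b (fst s) (snd s))"
  \<comment> \<open>The \<open>\<beta>\<close> term comes first so that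
    \<open>chart_monomial\<close> applies with its two weights exchanged.\<close>
  define d where "d = (\<lambda>s. nat (D - int \<beta> * snd s - int \<alpha> * fst s))"
  have fin: "finite S" and X_eq: "X = field_on a b UNIV"
    using X by (auto simp: polynomial_vector_field_def S_def)
  have deg: "int \<beta> * snd s + int \<alpha> * fst s \<le> D" if "s \<in> S" for s
    using weighted_degree_ge[OF fin[unfolded S_def] that[unfolded S_def], of \<alpha> \<beta>]
    by (simp add: D_def add.commute)
  show ?thesis
  proof (rule compactified_at_infinity[OF fin u _ _ sing, where f = "\<lambda>s. b' s * \<sigma> powi snd s"
        and g = "\<lambda>s. a' s * \<sigma> powi snd s" and k = fst and d = d
        and r = "real \<alpha> / real \<beta>" and t = "(- 1 / real \<beta>)"], fold D_def)
    fix q :: plane assume q: "q $ 1 \<noteq> 0" "q $ 2 \<noteq> 0"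
    define x y where "x = chart_y \<sigma> \<alpha> \<beta> q $ 1" and "y = chart_y \<sigma> \<alpha> \<beta> q $ 2"
    define A B where "A = (\<Sum>s\<in>S. a' s * (x powi fst s * y powi snd s))"
      and "B = (\<Sum>s\<in>S. b' s * (x powi fst s * y powi snd s))"
    have xy: "x = q $ 1 * (q $ 2) powi (- int \<alpha>)" "y = \<sigma> * (q $ 2) powi (- int \<beta>)"
      by (simp_all add: x_def y_def chart_y_def)
    then have "x \<noteq> 0" "y \<noteq> 0" using \<sigma> q by auto
    then have "X (chart_y \<sigma> \<alpha> \<beta> q) = vector [x * A, y * B]"
      unfolding X_eq x_def y_def A_def B_def a'_def b'_def S_def
      by (subst field_on_off_axes) (simp_all add: case_prod_unfold)
    then have cov: "change_of_variables (chart_y \<sigma> \<alpha> \<beta>) X q = vector [q $ 1 * (A - real \<alpha> / real \<beta> * B), q $ 2 * (- B / real \<beta>)]"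
      using pos \<sigma> q unfolding x_def y_def by (intro change_of_variables_chart_y)
    have sum: "(q $ 2) powi D * (\<Sum>s\<in>S. h s * (x powi fst s * y powi snd s)) =
        (\<Sum>s\<in>S. h s * \<sigma> powi snd s * (q $ 1) powi fst s * (q $ 2) ^ d s)" for h
      unfolding sum_distrib_left
    proof (intro sum.cong refl)
      fix s assume "s \<in> S"
      note chart_monomial[OF q(2) deg[OF this], of \<sigma> "q $ 1"]
      then have "(q $ 2) powi D * (x powi fst s * y powi snd s) =
          \<sigma> powi snd s * (q $ 1) powi fst s * (q $ 2) ^ d s"
        unfolding xy d_def by (simp only: mult_ac)
      then show "(q $ 2) powi D * (h s * (x powi fst s * y powi snd s)) =
          h s * \<sigma> powi snd s * (q $ 1) powi fst s * (q $ 2) ^ d s"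
        by (simp only: mult_ac)
    qed
    show "(q $ 2) powi D *\<^sub>R change_of_variables (chart_y \<sigma> \<alpha> \<beta>) X q =
      vector [q $ 1 * ((\<Sum>s\<in>S. a' s * \<sigma> powi snd s * (q $ 1) powi fst s * (q $ 2) ^ d s) -
                real \<alpha> / real \<beta> * (\<Sum>s\<in>S. b' s * \<sigma> powi snd s * (q $ 1) powi fst s * (q $ 2) ^ d s)),
              q $ 2 * ((- 1 / real \<beta>) * (\<Sum>s\<in>S. b' s * \<sigma> powi snd s * (q $ 1) powi fst s * (q $ 2) ^ d s))]"
      unfolding cov sum[symmetric] A_def[symmetric] B_def[symmetric]
      by (simp add: vec_eq_iff forall_2 algebra_simps)
  next
    let ?T = "{s. s \<in> S \<and> d s = 0}"
    let ?p = "vector [u, \<sigma>] :: plane"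
    have T: "support a b \<inter> {(m, n). int \<alpha> * m + int \<beta> * n = D} = ?T"
      using deg by (force simp: S_def d_def)
    have "field_on a b {(m, n). int \<alpha> * m + int \<beta> * n = D} ?p \<noteq> 0"
      unfolding D_def by (rule top_part_nonzero[OF _ ne nondeg pos]) (use fin u \<sigma> in \<open>auto simp: S_def\<close>)
    then show "(\<Sum>s\<in>?T. b' s * \<sigma> powi snd s * u powi fst s) \<noteq> 0 \<or>
        (\<Sum>s\<in>?T. a' s * \<sigma> powi snd s * u powi fst s) \<noteq> 0"
      using u \<sigma> by (subst (asm) field_on_off_axes)
        (auto simp: T[unfolded case_prod_unfold] case_prod_unfold a'_def b'_def vec_eq_iff forall_2 mult_ac)
  qed (use pos in auto)
qed

theorem proposition15:
  fixes X :: "plane \<Rightarrow> plane" and a b :: coeffs and \<alpha> \<beta> :: nat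
  assumes "polynomial_vector_field X a b"
    and "support a b \<noteq> {}"
    and "upper_part_nondegenerate a b"
    and "suitable_weight a b \<alpha> \<beta>"
  shows "\<forall>\<phi> \<in> {chart_x 1 \<alpha> \<beta>, chart_x (-1) \<alpha> \<beta>, chart_y 1 \<alpha> \<beta>, chart_y (-1) \<alpha> \<beta>}.
           \<forall>u. u \<noteq> 0 \<and> singularity (compactified \<phi> (weighted_degree a b \<alpha> \<beta>) X) (vector [u, 0]) \<longrightarrow>
             hyperbolic (compactified \<phi> (weighted_degree a b \<alpha> \<beta>) X) (vector [u, 0]) \<or>
             semi_hyperbolic (compactified \<phi> (weighted_degree a b \<alpha> \<beta>) X) (vector [u, 0])"
proof -
  \<comment> \<open>Both branches of \<open>suitable_weight\<close> give positive weights.\<close>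
  have pos: "\<alpha> > 0" "\<beta> > 0"
    using assms(4) by (auto simp: suitable_weight_def split: if_splits)
  have "hyperbolic (compactified \<phi> (weighted_degree a b \<alpha> \<beta>) X) (vector [u, 0]) \<or>
      semi_hyperbolic (compactified \<phi> (weighted_degree a b \<alpha> \<beta>) X) (vector [u, 0])"
    if "\<sigma> \<noteq> 0" "\<phi> = chart_x \<sigma> \<alpha> \<beta> \<or> \<phi> = chart_y \<sigma> \<alpha> \<beta>" "u \<noteq> 0"
      "singularity (compactified \<phi> (weighted_degree a b \<alpha> \<beta>) X) (vector [u, 0])" for \<sigma> \<phi> u
    using that singularity_chart_x[OF assms(1-3) pos] singularity_chart_y[OF assms(1-3) pos]
    by blast
  from this[of 1] this[of "-1"] show ?thesis
    by auto
qed

end
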